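(* Let $S,Y\in\mathbb{R}^{n\times m}$ be of full rank, with $n\ge m$. (i) The solution $B\in\mathbb{R}^{m\times m}$ to $\min_{B=B^T}\|Y-SB\|$ satisfies $\mathrm{sym}(S^TS\,B-S^TY)=0$. (ii) The solution $H\in\mathbb{R}^{m\times m}$ to $\min_{H=H^T}\|YH-S\|$ satisfies $\mathrm{sym}(Y^TY\,H-Y^TS)=0$.
   Context: $\|\cdot\|$ denotes the Frobenius norm. For a square matrix $M$, $\mathrm{sym}(M)=\tfrac12(M+M^T)$. The minimizations are over all real symmetric $m\times m$ matrices $B$, respectively $H$. *)

theory Defs
  imports "HOL-Analysis.Analysis"
begin

definition frobenius_norm :: "real^'m^'n \<Rightarrow> real" where
  "frobenius_norm A = sqrt (\<Sum>i\<in>UNIV. \<Sum>j\<in>UNIV. (A $ i $ j)\<^sup>2)"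

text \<open>The type \<open>real^'m^'n\<close> already carries this norm as its library \<^const>\<open>norm\<close>.\<close>

lemma frobenius_norm_eq_norm: "frobenius_norm A = norm A"
  by (simp add: frobenius_norm_def norm_vec_def L2_set_def sum_nonneg)

definition sym_part :: "real^'m^'m \<Rightarrow> real^'m^'m" where
  "sym_part M = (1/2) *\<^sub>R (M + transpose M)"

definition symmetric_matrix :: "real^'m^'m \<Rightarrow> bool" where
  "symmetric_matrix M \<longleftrightarrow> M = transpose M"

definition full_rank :: "real^'m^'n \<Rightarrow> bool" where
  "full_rank A \<longleftrightarrow> rank A = min CARD('n) CARD('m)"

end

theory Submission imports Defs begin

text \<open>
  Both parts are one linear least squares problem: given \<open>A\<close> of full column rank and \<open>C\<close>,
  approximate \<open>C\<close> by \<open>A ** X\<close> with \<open>X\<close> in the subspace of symmetric matrices. Since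
  \<open>frobenius_norm\<close> is the norm of the Euclidean space of matrices, \<open>X\<close> is optimal exactly when
  the residual \<open>C - A ** X\<close> is orthogonal to all \<open>A ** W\<close> with \<open>W\<close> symmetric, and such an \<open>X\<close>
  exists by orthogonal projection onto the image of the subspace. Full column rank makes
  \<open>X \<mapsto> A ** X\<close> injective, so \<open>X\<close> is unique (\<open>least_squares_on_subspace\<close>).

  Moving \<open>A\<close> to the other side of the inner product, the optimality condition says that
  \<open>transpose A ** (C - A ** X)\<close> is orthogonal to every symmetric matrix. Testing it against its
  own symmetric part shows that this part vanishes (\<open>sym_part_eq_0_if_orthogonal\<close>), which is the
  claimed equation. Part (i) is the case \<open>A = S\<close>, \<open>C = Y\<close>; part (ii) is the case \<open>A = Y\<close>,
  \<open>C = S\<close>, up to the sign of the residual.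
\<close>

text \<open>
  Pythagoras: if the residual at \<open>w\<close> is orthogonal to the image of \<open>W\<close>, then moving to another
  \<open>v\<close> increases the squared distance by exactly the square of the norm of \<open>f v - f w\<close>. This gives
  minimality of \<open>w\<close>, and uniqueness because \<open>f\<close> is injective on \<open>W\<close>.
\<close>
lemma least_squares_on_subspace:
  fixes f :: "'a::real_vector \<Rightarrow> 'b::euclidean_space"
  assumes f: "linear f" and inj: "inj_on f W" and W: "subspace W"
  obtains w where "w \<in> W" and "\<And>v. v \<in> W \<Longrightarrow> (y - f w) \<bullet> f v = 0"
    and "\<And>v. is_arg_min (\<lambda>x. norm (y - f x)) (\<lambda>x. x \<in> W) v \<longleftrightarrow> v = w"
proof -
  have "subspace (f ` W)"
    using f W by (rule linear_subspace_image)
  then have span: "span (f ` W) = f ` W"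
    by simp
  obtain p z where "p \<in> span (f ` W)" and z: "\<And>u. u \<in> span (f ` W) \<Longrightarrow> orthogonal z u"
    and y: "y = p + z"
    using orthogonal_subspace_decomp_exists[of "f ` W" y] by metis
  then obtain w where w: "w \<in> W" and p: "p = f w"
    unfolding span by blast
  have orth: "(y - f w) \<bullet> f v = 0" if "v \<in> W" for v
    using z[of "f v"] that unfolding span by (simp add: y p orthogonal_def)
  have pyth: "(norm (y - f v))\<^sup>2 = (norm (y - f w))\<^sup>2 + (norm (f v - f w))\<^sup>2" if v: "v \<in> W" for v
  proof -
    have "(y - f w) \<bullet> (f w - f v) = 0"
      using orth[OF w] orth[OF v] by (simp add: inner_diff_right)
    then have "(norm ((y - f w) + (f w - f v)))\<^sup>2 = (norm (y - f w))\<^sup>2 + (norm (f w - f v))\<^sup>2"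
      by (intro norm_add_Pythagorean) (simp add: orthogonal_def)
    then show ?thesis
      by (simp add: norm_minus_commute)
  qed
  have le: "norm (y - f w) \<le> norm (y - f v)" if "v \<in> W" for v
    using pyth[OF that] by (simp add: power2_le_imp_le)
  have "is_arg_min (\<lambda>x. norm (y - f x)) (\<lambda>x. x \<in> W) v \<longleftrightarrow> v = w" for v
  proof
    assume min: "is_arg_min (\<lambda>x. norm (y - f x)) (\<lambda>x. x \<in> W) v"
    then have v: "v \<in> W" and "norm (y - f v) \<le> norm (y - f w)"
      using w by (auto simp: is_arg_min_linorder)
    then have "norm (y - f v) = norm (y - f w)"
      using le by (simp add: order_antisym)
    then have "f v = f w"
      using pyth[OF v] by simp
    then show "v = w"
      using inj v w by (simp add: inj_on_eq_iff)
  next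
    assume "v = w"
    then show "is_arg_min (\<lambda>x. norm (y - f x)) (\<lambda>x. x \<in> W) v"
      using w le by (simp add: is_arg_min_linorder)
  qed
  with w orth that show thesis
    by blast
qed

lemma subspace_symmetric_matrix: "subspace {W :: real^'m^'m. symmetric_matrix W}"
  unfolding subspace_def symmetric_matrix_def
  by (auto simp: transpose_def vec_eq_iff)

lemma symmetric_matrix_sym_part: "symmetric_matrix (sym_part M)"
  by (simp add: symmetric_matrix_def sym_part_def transpose_def vec_eq_iff add.commute)

lemma inner_transpose: "transpose A \<bullet> transpose B = A \<bullet> B"
  for A B :: "real^'m^'n"
  unfolding inner_vec_def transpose_def by (simp, rule sum.swap)

lemma inner_matrix_mult_right: "C \<bullet> (A ** X) = (transpose A ** C) \<bullet> X"
  for A :: "real^'m^'n" and C :: "real^'k^'n" and X :: "real^'k^'m"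
proof -
  have "C \<bullet> (A ** X) = (\<Sum>i\<in>UNIV. \<Sum>j\<in>UNIV. \<Sum>k\<in>UNIV. A $ i $ k * C $ i $ j * X $ k $ j)"
    by (simp add: inner_vec_def matrix_matrix_mult_def sum_distrib_left mult_ac)
  also have "\<dots> = (\<Sum>i\<in>UNIV. \<Sum>k\<in>UNIV. \<Sum>j\<in>UNIV. A $ i $ k * C $ i $ j * X $ k $ j)"
    by (intro sum.cong refl sum.swap)
  also have "\<dots> = (\<Sum>k\<in>UNIV. \<Sum>i\<in>UNIV. \<Sum>j\<in>UNIV. A $ i $ k * C $ i $ j * X $ k $ j)"
    by (rule sum.swap)
  also have "\<dots> = (\<Sum>k\<in>UNIV. \<Sum>j\<in>UNIV. \<Sum>i\<in>UNIV. A $ i $ k * C $ i $ j * X $ k $ j)"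
    by (intro sum.cong refl sum.swap)
  also have "\<dots> = (transpose A ** C) \<bullet> X"
    by (simp add: inner_vec_def matrix_matrix_mult_def transpose_def sum_distrib_right)
  finally show ?thesis .
qed

text \<open>
  Symmetric and skew-symmetric matrices are orthogonal, so the inner product of \<open>M\<close> with its
  symmetric part is the squared norm of that part.
\<close>
lemma sym_part_eq_0_if_orthogonal:
  assumes "\<And>W. symmetric_matrix W \<Longrightarrow> M \<bullet> W = 0"
  shows "sym_part M = 0"
proof -
  have "transpose M \<bullet> transpose M = M \<bullet> M"
    by (rule inner_transpose)
  then have "sym_part M \<bullet> sym_part M = M \<bullet> sym_part M"
    unfolding sym_part_def inner_scaleR_left inner_scaleR_right inner_add_left inner_add_right
      inner_commute[of "transpose M" M]
    by argo
  also have "\<dots> = 0"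
    by (intro assms symmetric_matrix_sym_part)
  finally show ?thesis
    by simp
qed

lemma inj_matrix_mult_if_full_rank:
  fixes A :: "real^'m^'n"
  assumes "CARD('m) \<le> CARD('n)" and "full_rank A"
  shows "inj (\<lambda>X :: real^'k^'m. A ** X)"
proof -
  have "inj ((*v) A)"
    using assms by (simp add: full_rank_def full_rank_injective)
  then obtain L where "L ** A = mat 1"
    using matrix_left_invertible_injective by blast
  then have "L ** (A ** X) = X" for X :: "real^'k^'m"
    by (simp add: matrix_mul_assoc)
  then show ?thesis
    by (rule inj_on_inverseI)
qed

lemma symmetric_least_squares:
  fixes A C :: "real^'m^'n"
  assumes "CARD('m) \<le> CARD('n)" and "full_rank A"
  obtains X where "sym_part (transpose A ** A ** X - transpose A ** C) = 0"
    and "\<And>X'. is_arg_min (\<lambda>X. frobenius_norm (C - A ** X)) symmetric_matrix X' \<longleftrightarrow> X' = X"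
proof -
  have lin: "linear (\<lambda>X :: real^'m^'m. A ** X)"
    by (intro linearI)
      (auto simp: vec_eq_iff matrix_matrix_mult_def sum.distrib sum_distrib_left algebra_simps)
  have inj: "inj_on (\<lambda>X :: real^'m^'m. A ** X) {W. symmetric_matrix W}"
    using inj_matrix_mult_if_full_rank[OF assms] by (rule inj_on_subset) simp
  obtain X where "symmetric_matrix X"
    and orth: "\<And>W. symmetric_matrix W \<Longrightarrow> (C - A ** X) \<bullet> (A ** W) = 0"
    and min: "\<And>X'. is_arg_min (\<lambda>X. norm (C - A ** X)) symmetric_matrix X' \<longleftrightarrow> X' = X"
    by (rule least_squares_on_subspace[OF lin inj subspace_symmetric_matrix, of C,
          unfolded mem_Collect_eq])
      (rule that, assumption, simp, simp)
  have "sym_part (transpose A ** A ** X - transpose A ** C) = 0"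
  proof (rule sym_part_eq_0_if_orthogonal)
    fix W :: "real^'m^'m"
    assume "symmetric_matrix W"
    then have "C \<bullet> (A ** W) = (A ** X) \<bullet> (A ** W)"
      using orth by (simp add: inner_diff_left)
    then show "(transpose A ** A ** X - transpose A ** C) \<bullet> W = 0"
      by (simp add: inner_diff_left inner_matrix_mult_right matrix_mul_assoc)
  qed
  with min that show thesis
    by (simp add: frobenius_norm_eq_norm)
qed

theorem proposition6:
  fixes S Y :: "real^'m^'n"
  assumes "CARD('n) \<ge> CARD('m)"
    and "full_rank S" and "full_rank Y"
  shows "((\<exists>!B :: real^'m^'m.
             is_arg_min (\<lambda>B. frobenius_norm (Y - S ** B)) symmetric_matrix B) \<and>
          (\<forall>B :: real^'m^'m.
             is_arg_min (\<lambda>B. frobenius_norm (Y - S ** B)) symmetric_matrix B \<longrightarrow>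
             sym_part (transpose S ** S ** B - transpose S ** Y) = 0)) \<and>
         ((\<exists>!H :: real^'m^'m.
             is_arg_min (\<lambda>H. frobenius_norm (Y ** H - S)) symmetric_matrix H) \<and>
          (\<forall>H :: real^'m^'m.
             is_arg_min (\<lambda>H. frobenius_norm (Y ** H - S)) symmetric_matrix H \<longrightarrow>
             sym_part (transpose Y ** Y ** H - transpose Y ** S) = 0))"
proof -
  obtain B where "sym_part (transpose S ** S ** B - transpose S ** Y) = 0"
    and "\<And>B'. is_arg_min (\<lambda>B. frobenius_norm (Y - S ** B)) symmetric_matrix B' \<longleftrightarrow> B' = B"
    using symmetric_least_squares[OF assms(1,2)] by blast
  moreover obtain H where "sym_part (transpose Y ** Y ** H - transpose Y ** S) = 0"
    and "\<And>H'. is_arg_min (\<lambda>H. frobenius_norm (S - Y ** H)) symmetric_matrix H' \<longleftrightarrow> H' = H"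
    using symmetric_least_squares[OF assms(1,3)] by blast
  moreover have "frobenius_norm (Y ** H - S) = frobenius_norm (S - Y ** H)" for H :: "real^'m^'m"
    by (simp add: frobenius_norm_eq_norm norm_minus_commute)
  ultimately show ?thesis
    by simp
qed

end
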